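(* A non-abelian nilpotent pseudo-Hermitian quadratic Lie algebra $(\mathfrak g,J,\varphi)$ is Lorentz-Hermitian if and only if it is (up to equivalence) the orthogonal direct sum of an abelian Hermitian Lie algebra (possibly zero) and the $6$-dimensional Lorentz-Hermitian Lie algebra $\mathcal L=\mathrm{span}_{\mathbb R}\{x_1,Jx_1,x_2,Jx_2,x_3,Jx_3\}$ with nonzero brackets and $\varphi$-pairings given by $$[x_1,Jx_1]=x_2,\quad [x_1,x_2]=-Jx_3,\quad [Jx_1,x_2]=x_3,$$ $$\varphi(x_1,x_3)=\varphi(Jx_1,Jx_3)=1,\quad \varphi(x_2,x_2)=\varphi(Jx_2,Jx_2)=1.$$
   Context: All Lie algebras are real. A complex structure on a Lie algebra $\mathfrak g$ is a linear map $J:\mathfrak g\to\mathfrak g$ with $J^2=-I$ and $[x,y]+J[Jx,y]+J[x,Jy]-[Jx,Jy]=0$ for all $x,y$. A pseudo-Hermitian Lie algebra is a triple $(\mathfrak g,J,\varphi)$ with $J$ a complex structure and $\varphi$ a non-degenerate symmetric bilinear form with $\varphi(Jx,Jy)=\varphi(x,y)$ for all $x,y$; it is a pseudo-Hermitian quadratic Lie algebra if moreover $\varphi([x,y],z)+\varphi(y,[x,z])=0$ for all $x,y,z$. Signatures are written (number of negative squares, number of positive squares). On a $2n$-dimensional algebra, $\varphi$ is called Hermitian if it is positive definite (signature $(0,2n)$) and Lorentz-Hermitian if its signature is $(2,2n-2)$. Two pseudo-Hermitian Lie algebras are equivalent if there is a Lie algebra isomorphism commuting with the complex structures and preserving the metrics.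 In an orthogonal direct sum, bracket, complex structure and metric are the direct sums of those of the summands. Unlisted brackets and pairings of basis vectors (up to skewsymmetry, resp. symmetry) are zero. *)

theory Defs
  imports "HOL-Analysis.Analysis"
begin

text \<open>
  Structures live on a linear subspace \<open>vspace\<close> of an ambient real vector space type; the
  operations are only meaningful on that subspace, and every notion below is relativised to it.
\<close>

record 'a ph_alg =
  vspace :: "'a set"
  bracket :: "'a \<Rightarrow> 'a \<Rightarrow> 'a"
  cplx :: "'a \<Rightarrow> 'a"
  metric :: "'a \<Rightarrow> 'a \<Rightarrow> real"

definition linear_map_on :: "'a::real_vector set \<Rightarrow> ('a \<Rightarrow> 'b::real_vector) \<Rightarrow> bool" where
  "linear_map_on V f \<longleftrightarrow>
     (\<forall>x\<in>V. \<forall>y\<in>V. f (x + y) = f x + f y) \<and> (\<forall>c. \<forall>x\<in>V. f (c *\<^sub>R x) = c *\<^sub>R f x)"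

definition bilinear_map_on :: "'a::real_vector set \<Rightarrow> ('a \<Rightarrow> 'a \<Rightarrow> 'b::real_vector) \<Rightarrow> bool" where
  "bilinear_map_on V f \<longleftrightarrow>
     (\<forall>x\<in>V. linear_map_on V (f x)) \<and> (\<forall>y\<in>V. linear_map_on V (\<lambda>x. f x y))"

text \<open>Real, finite-dimensional Lie algebras; the zero algebra is allowed.\<close>

definition lie_algebra :: "'a::real_vector set \<Rightarrow> ('a \<Rightarrow> 'a \<Rightarrow> 'a) \<Rightarrow> bool" where
  "lie_algebra V br \<longleftrightarrow>
     subspace V \<and> (\<exists>B. finite B \<and> span B = V) \<and>
     (\<forall>x\<in>V. \<forall>y\<in>V. br x y \<in> V) \<and> bilinear_map_on V br \<and>
     (\<forall>x\<in>V. br x x = 0) \<and>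
     (\<forall>x\<in>V. \<forall>y\<in>V. \<forall>z\<in>V. br x (br y z) + br y (br z x) + br z (br x y) = 0)"

definition complex_structure ::
    "'a::real_vector set \<Rightarrow> ('a \<Rightarrow> 'a \<Rightarrow> 'a) \<Rightarrow> ('a \<Rightarrow> 'a) \<Rightarrow> bool" where
  "complex_structure V br J \<longleftrightarrow>
     (\<forall>x\<in>V. J x \<in> V) \<and> linear_map_on V J \<and> (\<forall>x\<in>V. J (J x) = - x) \<and>
     (\<forall>x\<in>V. \<forall>y\<in>V. br x y + J (br (J x) y) + J (br x (J y)) - br (J x) (J y) = 0)"

definition pseudo_hermitian :: "'a::real_vector ph_alg \<Rightarrow> bool" where
  "pseudo_hermitian G \<longleftrightarrow>
     lie_algebra (vspace G) (bracket G) \<and>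
     complex_structure (vspace G) (bracket G) (cplx G) \<and>
     bilinear_map_on (vspace G) (metric G) \<and>
     (\<forall>x\<in>vspace G. \<forall>y\<in>vspace G. metric G x y = metric G y x) \<and>
     (\<forall>x\<in>vspace G. (\<forall>y\<in>vspace G. metric G x y = 0) \<longrightarrow> x = 0) \<and>
     (\<forall>x\<in>vspace G. \<forall>y\<in>vspace G. metric G (cplx G x) (cplx G y) = metric G x y)"

definition pseudo_hermitian_quadratic :: "'a::real_vector ph_alg \<Rightarrow> bool" where
  "pseudo_hermitian_quadratic G \<longleftrightarrow>
     pseudo_hermitian G \<and>
     (\<forall>x\<in>vspace G. \<forall>y\<in>vspace G. \<forall>z\<in>vspace G.
        metric G (bracket G x y) z + metric G y (bracket G x z) = 0)"

definition abelian :: "'a::real_vector ph_alg \<Rightarrow> bool" where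
  "abelian G \<longleftrightarrow> (\<forall>x\<in>vspace G. \<forall>y\<in>vspace G. bracket G x y = 0)"

primrec lower_central :: "'a::real_vector ph_alg \<Rightarrow> nat \<Rightarrow> 'a set" where
  "lower_central G 0 = vspace G"
| "lower_central G (Suc k) = span {bracket G x y | x y. x \<in> vspace G \<and> y \<in> lower_central G k}"

definition nilpotent :: "'a::real_vector ph_alg \<Rightarrow> bool" where
  "nilpotent G \<longleftrightarrow> (\<exists>k. lower_central G k = {0})"

text \<open>
  Signature (number of negative squares, number of positive squares), read off from an
  orthogonal basis; by Sylvester's law of inertia the counts do not depend on the basis.
\<close>

definition has_signature ::
    "'a::real_vector set \<Rightarrow> ('a \<Rightarrow> 'a \<Rightarrow> real) \<Rightarrow> nat \<Rightarrow> nat \<Rightarrow> bool" where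
  "has_signature V \<phi> p q \<longleftrightarrow>
     (\<exists>B. finite B \<and> independent B \<and> span B = V \<and>
        (\<forall>b\<in>B. \<forall>c\<in>B. b \<noteq> c \<longrightarrow> \<phi> b c = 0) \<and>
        card {b\<in>B. \<phi> b b < 0} = p \<and> card {b\<in>B. \<phi> b b > 0} = q)"

definition hermitian :: "'a::real_vector ph_alg \<Rightarrow> bool" where
  "hermitian G \<longleftrightarrow> pseudo_hermitian G \<and> (\<forall>x\<in>vspace G. x \<noteq> 0 \<longrightarrow> metric G x x > 0)"

definition lorentz_hermitian :: "'a::real_vector ph_alg \<Rightarrow> bool" where
  "lorentz_hermitian G \<longleftrightarrow>
     pseudo_hermitian G \<and>
     (\<exists>n\<ge>1. dim (vspace G) = 2 * n \<and> has_signature (vspace G) (metric G) 2 (2 * n - 2))"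

definition equivalent :: "'a::real_vector ph_alg \<Rightarrow> 'b::real_vector ph_alg \<Rightarrow> bool" where
  "equivalent G H \<longleftrightarrow>
     (\<exists>f. linear_map_on (vspace G) f \<and> bij_betw f (vspace G) (vspace H) \<and>
        (\<forall>x\<in>vspace G. \<forall>y\<in>vspace G. f (bracket G x y) = bracket H (f x) (f y)) \<and>
        (\<forall>x\<in>vspace G. f (cplx G x) = cplx H (f x)) \<and>
        (\<forall>x\<in>vspace G. \<forall>y\<in>vspace G. metric H (f x) (f y) = metric G x y))"

definition orth_sum ::
    "'a::real_vector ph_alg \<Rightarrow> 'b::real_vector ph_alg \<Rightarrow> ('a \<times> 'b) ph_alg" where
  "orth_sum G H =
     \<lparr> vspace = vspace G \<times> vspace H,
       bracket = (\<lambda>u v. (bracket G (fst u) (fst v), bracket H (snd u) (snd v))),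
       cplx = (\<lambda>u. (cplx G (fst u), cplx H (snd u))),
       metric = (\<lambda>u v. metric G (fst u) (fst v) + metric H (snd u) (snd v)) \<rparr>"

text \<open>
  The algebra \<open>\<L>\<close> on \<open>\<real>\<^sup>6\<close>, with coordinates indexed by the names of its basis vectors.
\<close>

datatype L_index = X1 | JX1 | X2 | JX2 | X3 | JX3

lemma UNIV_L_index: "UNIV = {X1, JX1, X2, JX2, X3, JX3}"
  using L_index.exhaust by blast

instance L_index :: finite
  by standard (simp add: UNIV_L_index)

abbreviation L_vec :: "L_index \<Rightarrow> real ^ L_index" where
  "L_vec i \<equiv> axis i 1"

text \<open>\<open>wedge i j\<close> and \<open>sprod i j\<close> are the skew and symmetric products of the coordinate forms.\<close>

definition wedge :: "L_index \<Rightarrow> L_index \<Rightarrow> real ^ L_index \<Rightarrow> real ^ L_index \<Rightarrow> real" where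
  "wedge i j u v = u $ i * v $ j - u $ j * v $ i"

definition sprod :: "L_index \<Rightarrow> L_index \<Rightarrow> real ^ L_index \<Rightarrow> real ^ L_index \<Rightarrow> real" where
  "sprod i j u v = u $ i * v $ j + u $ j * v $ i"

definition L_alg :: "(real ^ L_index) ph_alg" where
  "L_alg =
     \<lparr> vspace = UNIV,
       bracket = (\<lambda>u v. wedge X1 JX1 u v *\<^sub>R L_vec X2 - wedge X1 X2 u v *\<^sub>R L_vec JX3
                         + wedge JX1 X2 u v *\<^sub>R L_vec X3),
       cplx = (\<lambda>u. u $ X1 *\<^sub>R L_vec JX1 - u $ JX1 *\<^sub>R L_vec X1
                   + u $ X2 *\<^sub>R L_vec JX2 - u $ JX2 *\<^sub>R L_vec X2
                   + u $ X3 *\<^sub>R L_vec JX3 - u $ JX3 *\<^sub>R L_vec X3),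
       metric = (\<lambda>u v. sprod X1 X3 u v + sprod JX1 JX3 u v + u $ X2 * v $ X2 + u $ JX2 * v $ JX2) \<rparr>"

lemma L_alg_basis:
  "bracket L_alg (L_vec X1) (L_vec JX1) = L_vec X2"
  "bracket L_alg (L_vec X1) (L_vec X2) = - L_vec JX3"
  "bracket L_alg (L_vec JX1) (L_vec X2) = L_vec X3"
  "cplx L_alg (L_vec X1) = L_vec JX1"
  "cplx L_alg (L_vec X2) = L_vec JX2"
  "cplx L_alg (L_vec X3) = L_vec JX3"
  "metric L_alg (L_vec X1) (L_vec X3) = 1"
  "metric L_alg (L_vec JX1) (L_vec JX3) = 1"
  "metric L_alg (L_vec X2) (L_vec X2) = 1"
  "metric L_alg (L_vec JX2) (L_vec JX2) = 1"
  by (simp_all add: L_alg_def wedge_def sprod_def axis_def)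

end

theory Submission
  imports Defs
begin

text \<open>
  Write \<open>\<phi>\<close> for the metric and \<open>J\<close> for the complex structure of \<open>G\<close>.

  Suppose first that \<open>\<phi>\<close> has exactly two negative squares. The last nonzero term of the lower central
  series contains a central vector \<open>w \<noteq> 0\<close>, and it is null because the centre is orthogonal to all
  brackets (\<open>central_null_vector_exists\<close>). The plane \<open>P = span {w, J w}\<close> is then totally isotropic and,
  by the signature, maximal with this property: on \<open>Q = P\<^sup>\<bottom>\<close> the metric is positive semidefinite and its
  null vectors are exactly those of \<open>P\<close> (\<open>nonpositive_in_plane\<close>). Everything rests on combining this
  with one remark: if a nilpotent map \<open>D\<close> is skew for a positive semidefinite form, then \<open>D v\<close> is a null
  vector for every \<open>v\<close> (\<open>skew_nilpotent_null\<close>). Hence \<open>ad x\<close> maps \<open>Q\<close> into \<open>P\<close> whenever it preserves \<open>Q\<close>.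

  The main step is that \<open>J w\<close> is central as well (\<open>Jw_central\<close>). Since \<open>w\<close> is central, integrability
  of \<open>J\<close> says that \<open>D = ad (J w)\<close> commutes with \<open>J\<close>. Let \<open>u\<close> be dual to \<open>w\<close> and \<open>q = D u\<close>. One computes
  \<open>D q = - \<phi>(q,q) w\<close>, so by applying \<open>J\<close> the bracket of \<open>J w\<close> with \<open>J q\<close> is \<open>- \<phi>(q,q) J w\<close>; thus
  \<open>J w\<close> is an eigenvector of \<open>ad (J q)\<close>, and nilpotency forces \<open>\<phi>(q,q) = 0\<close>. From there \<open>D = 0\<close> follows.

  Now all brackets are orthogonal to \<open>P\<close>, so every \<open>ad x\<close> maps \<open>Q\<close> into \<open>P\<close>, and invariance of \<open>\<phi>\<close>
  expresses the whole bracket through the single vector \<open>z = [u, J u]\<close> of \<open>Q\<close> (\<open>br_formula\<close>). As \<open>G\<close> is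
  not abelian, \<open>z\<close> is not null, and suitable multiples of \<open>u\<close>, \<open>z\<close>, \<open>w\<close> are the vectors \<open>x\<^sub>1\<close>, \<open>x\<^sub>2\<close>, \<open>x\<^sub>3\<close>
  of a copy of \<open>\<L>\<close>. The orthogonal complement of this copy lies in \<open>Q\<close> and meets \<open>P\<close> trivially, so it
  is positive definite, and it is abelian by the bracket formula.

  Conversely, a positive definite Hermitian space has an orthogonal basis of even size, built from pairs
  \<open>x\<close>, \<open>J x\<close> (\<open>unitary_basis_exists\<close>); together with \<open>x\<^sub>1 \<plusminus> x\<^sub>3\<close>, \<open>J x\<^sub>1 \<plusminus> J x\<^sub>3\<close>, \<open>x\<^sub>2\<close>, \<open>J x\<^sub>2\<close> it
  shows that the orthogonal sum with \<open>\<L>\<close> has exactly two negative squares.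
\<close>

section \<open>Symmetric bilinear forms on a subspace\<close>

text \<open>
  Completeness is phrased as triviality of the orthogonal complement rather than as a spanning property,
  because in this form it is immediate to check for sums and along isometries;
  \<open>orth_basis_independent_span\<close> shows that such a set is a basis of \<open>V\<close>.
\<close>

definition orth_basis :: "'a::real_vector set \<Rightarrow> ('a \<Rightarrow> 'a \<Rightarrow> real) \<Rightarrow> 'a set \<Rightarrow> bool" where
  "orth_basis V \<phi> E \<longleftrightarrow>
     finite E \<and> E \<subseteq> V \<and> (\<forall>b\<in>E. \<forall>c\<in>E. b \<noteq> c \<longrightarrow> \<phi> b c = 0) \<and> (\<forall>b\<in>E. \<phi> b b \<noteq> 0) \<and>
     (\<forall>y\<in>V. (\<forall>b\<in>E. \<phi> y b = 0) \<longrightarrow> y = 0)"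

locale symmetric_form =
  fixes V :: "'a::real_vector set" and \<phi> :: "'a \<Rightarrow> 'a \<Rightarrow> real"
  assumes subspace_V: "subspace V"
    and bilinear: "bilinear_map_on V \<phi>"
    and sym: "x \<in> V \<Longrightarrow> y \<in> V \<Longrightarrow> \<phi> x y = \<phi> y x"
begin

lemma V_closed [simp, intro]:
  "0 \<in> V" "x \<in> V \<Longrightarrow> y \<in> V \<Longrightarrow> x + y \<in> V" "x \<in> V \<Longrightarrow> c *\<^sub>R x \<in> V"
  "x \<in> V \<Longrightarrow> - x \<in> V" "x \<in> V \<Longrightarrow> y \<in> V \<Longrightarrow> x - y \<in> V"
  using subspace_V by (simp_all add: subspace_0 subspace_add subspace_scale subspace_neg subspace_diff)

lemma form_linear [simp]:
  shows "x \<in> V \<Longrightarrow> y \<in> V \<Longrightarrow> z \<in> V \<Longrightarrow> \<phi> (x + y) z = \<phi> x z + \<phi> y z"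
    "x \<in> V \<Longrightarrow> y \<in> V \<Longrightarrow> z \<in> V \<Longrightarrow> \<phi> z (x + y) = \<phi> z x + \<phi> z y"
    "x \<in> V \<Longrightarrow> z \<in> V \<Longrightarrow> \<phi> (c *\<^sub>R x) z = c * \<phi> x z"
    "x \<in> V \<Longrightarrow> z \<in> V \<Longrightarrow> \<phi> z (c *\<^sub>R x) = c * \<phi> z x"
  using bilinear unfolding bilinear_map_on_def linear_map_on_def by auto

lemma form_minus_zero [simp]:
  shows "x \<in> V \<Longrightarrow> z \<in> V \<Longrightarrow> \<phi> (- x) z = - \<phi> x z"
    "x \<in> V \<Longrightarrow> z \<in> V \<Longrightarrow> \<phi> z (- x) = - \<phi> z x"
    "z \<in> V \<Longrightarrow> \<phi> 0 z = 0" "z \<in> V \<Longrightarrow> \<phi> z 0 = 0"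
  using form_linear(3,4)[of x z "-1"] form_linear(3,4)[of 0 z 0] by auto

lemma form_diff [simp]:
  assumes "x \<in> V" "y \<in> V" "z \<in> V"
  shows "\<phi> (x - y) z = \<phi> x z - \<phi> y z" "\<phi> z (x - y) = \<phi> z x - \<phi> z y"
  using form_linear(1,2)[of x "- y" z] assms by auto

lemma sum_closed [intro]: "(\<And>i. i \<in> I \<Longrightarrow> f i \<in> V) \<Longrightarrow> sum f I \<in> V"
  using subspace_V by (rule subspace_sum)

lemma form_sum_left:
  assumes "finite I" "\<And>i. i \<in> I \<Longrightarrow> f i \<in> V" "y \<in> V"
  shows "\<phi> (\<Sum>i\<in>I. f i) y = (\<Sum>i\<in>I. \<phi> (f i) y)"
  using assms by (induction I rule: finite_induct) (auto simp: sum_closed)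

text \<open>
  Fourier coefficients: pairing the projection of \<open>y\<close> onto the span of \<open>E\<close> with a member \<open>e\<close> leaves only
  the coefficient at \<open>e\<close>.
\<close>

lemma residual_orthogonal:
  assumes E: "finite E" "E \<subseteq> V" "\<forall>b\<in>E. \<forall>c\<in>E. b \<noteq> c \<longrightarrow> \<phi> b c = 0" "\<forall>b\<in>E. \<phi> b b \<noteq> 0"
    and y: "y \<in> V" and e: "e \<in> E"
  shows "\<phi> (y - (\<Sum>b\<in>E. (\<phi> y b / \<phi> b b) *\<^sub>R b)) e = 0"
proof -
  have eV: "e \<in> V" and bV: "\<And>b. b \<in> E \<Longrightarrow> b \<in> V" using E e by auto
  have "\<phi> (\<Sum>b\<in>E. (\<phi> y b / \<phi> b b) *\<^sub>R b) e = (\<Sum>b\<in>E. \<phi> y b / \<phi> b b * \<phi> b e)"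
    using E(1) bV eV by (simp add: form_sum_left)
  also have "\<dots> = (\<Sum>b\<in>E. if b = e then \<phi> y e else 0)"
    using E(3,4) e by (intro sum.cong) auto
  also have "\<dots> = \<phi> y e" using E(1) e by simp
  finally show ?thesis using y eV bV by (simp add: sum_closed)
qed

lemma orth_basis_expansion:
  assumes E: "orth_basis V \<phi> E" and y: "y \<in> V"
  shows "y = (\<Sum>b\<in>E. (\<phi> y b / \<phi> b b) *\<^sub>R b)"
proof -
  let ?s = "\<Sum>b\<in>E. (\<phi> y b / \<phi> b b) *\<^sub>R b"
  have bV: "\<And>b. b \<in> E \<Longrightarrow> b \<in> V" using E by (auto simp: orth_basis_def)
  have "\<forall>e\<in>E. \<phi> (y - ?s) e = 0"
    using E y residual_orthogonal[of E y] by (auto simp: orth_basis_def)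
  moreover have "y - ?s \<in> V" using y bV by (intro V_closed sum_closed) auto
  ultimately have "y - ?s = 0" using E unfolding orth_basis_def by blast
  then show ?thesis by simp
qed

text \<open>
  Parseval's identity. It turns the signs of the squares \<open>\<phi> b b\<close> into information on the sign of \<open>\<phi> y y\<close>.
\<close>

lemma orth_basis_form:
  assumes E: "orth_basis V \<phi> E" and y: "y \<in> V"
  shows "\<phi> y y = (\<Sum>b\<in>E. (\<phi> y b)\<^sup>2 / \<phi> b b)"
proof -
  have bV: "\<And>b. b \<in> E \<Longrightarrow> b \<in> V" and fin: "finite E" using E by (auto simp: orth_basis_def)
  have "\<phi> y y = \<phi> (\<Sum>b\<in>E. (\<phi> y b / \<phi> b b) *\<^sub>R b) y"
    using orth_basis_expansion[OF E y] by simp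
  also have "\<dots> = (\<Sum>b\<in>E. (\<phi> y b)\<^sup>2 / \<phi> b b)"
    using fin bV y by (auto simp: form_sum_left sym[of y] power2_eq_square intro!: sum.cong)
  finally show ?thesis .
qed

lemma orthogonal_independent:
  assumes "finite E" "E \<subseteq> V" "\<forall>b\<in>E. \<forall>c\<in>E. b \<noteq> c \<longrightarrow> \<phi> b c = 0" "\<forall>b\<in>E. \<phi> b b \<noteq> 0"
  shows "independent E"
proof (rule independent_if_scalars_zero[OF assms(1)])
  fix f x assume s: "(\<Sum>x\<in>E. f x *\<^sub>R x) = 0" and x: "x \<in> E"
  have bV: "\<And>b. b \<in> E \<Longrightarrow> b \<in> V" using assms by auto
  have "0 = \<phi> (\<Sum>b\<in>E. f b *\<^sub>R b) x" unfolding s using bV[OF x] by simp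
  also have "\<dots> = (\<Sum>b\<in>E. f b * \<phi> b x)" using assms(1) bV x by (simp add: form_sum_left)
  also have "\<dots> = (\<Sum>b\<in>E. if b = x then f x * \<phi> x x else 0)"
    using assms(3) x by (intro sum.cong) auto
  also have "\<dots> = f x * \<phi> x x" using assms(1) x by simp
  finally show "f x = 0" using assms(4) x by simp
qed

lemma orth_basis_independent_span:
  assumes E: "orth_basis V \<phi> E"
  shows "independent E" "span E = V"
proof -
  show "independent E" using E orthogonal_independent[of E] by (auto simp: orth_basis_def)
  show "span E = V"
  proof
    show "span E \<subseteq> V" using E subspace_V span_minimal[of E V] by (auto simp: orth_basis_def)
    show "V \<subseteq> span E"
    proof
      fix y assume "y \<in> V"
      then have "y = (\<Sum>b\<in>E. (\<phi> y b / \<phi> b b) *\<^sub>R b)" by (rule orth_basis_expansion[OF E])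
      also have "\<dots> \<in> span E" by (intro span_sum span_scale span_base)
      finally show "y \<in> span E" .
    qed
  qed
qed

text \<open>
  In an orthogonal basis without null vectors every member that is not negative is positive, so counting
  the negative ones suffices.
\<close>

lemma orth_basis_signature:
  assumes E: "orth_basis V \<phi> E" and neg: "card {b\<in>E. \<phi> b b < 0} = p"
  shows "dim V = card E" "has_signature V \<phi> p (card E - p)"
proof -
  note B = orth_basis_independent_span[OF E]
  have fin: "finite E" using E by (simp add: orth_basis_def)
  show "dim V = card E" using B by (metis dim_span_eq_card_independent)
  have "{b\<in>E. \<phi> b b > 0} = E - {b\<in>E. \<phi> b b < 0}" using E by (auto simp: orth_basis_def)
  then have "card {b\<in>E. \<phi> b b > 0} = card E - p" using fin neg by (simp add: card_Diff_subset)
  then show "has_signature V \<phi> p (card E - p)"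
    unfolding has_signature_def using B E neg by (auto simp: orth_basis_def)
qed

text \<open>
  The degenerate case of the Cauchy-Schwarz inequality: otherwise the square of \<open>y + t x\<close> would be
  a non-constant affine function of \<open>t\<close>, hence negative somewhere.
\<close>

lemma null_vector_radical:
  assumes "subspace Q" "Q \<subseteq> V" "\<And>v. v \<in> Q \<Longrightarrow> \<phi> v v \<ge> 0"
    and "x \<in> Q" "y \<in> Q" "\<phi> x x = 0"
  shows "\<phi> x y = 0"
proof (rule ccontr)
  assume c: "\<phi> x y \<noteq> 0"
  \<comment> \<open>With this \<open>t\<close> the square of \<open>y + t x\<close> equals \<open>-1\<close>.\<close>
  define t where "t = - (\<phi> y y + 1) / (2 * \<phi> x y)"
  have V: "x \<in> V" "y \<in> V" using assms by auto
  have "y + t *\<^sub>R x \<in> Q" using assms by (intro subspace_add subspace_scale)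
  then have "0 \<le> \<phi> (y + t *\<^sub>R x) (y + t *\<^sub>R x)" by (rule assms(3))
  also have "\<dots> = \<phi> y y + 2 * t * \<phi> x y" using V assms(6) by (simp add: sym[of y x] algebra_simps)
  also have "\<dots> = -1" using c by (simp add: t_def field_simps)
  finally show False by simp
qed

text \<open>
  By skewness, the square of \<open>D\<^sup>j\<^sup>+\<^sup>1 v\<close> is minus the pairing of \<open>D\<^sup>j v\<close> with \<open>D\<^sup>j\<^sup>+\<^sup>2 v\<close>, which vanishes as soon as
  \<open>D\<^sup>j\<^sup>+\<^sup>2 v\<close> is null. Starting from a power that kills \<open>v\<close>, nullity thus descends to \<open>D v\<close>.
\<close>

lemma skew_nilpotent_null:
  assumes Q: "subspace Q" "Q \<subseteq> V" "\<And>v. v \<in> Q \<Longrightarrow> \<phi> v v \<ge> 0"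
    and DQ: "\<And>v. v \<in> Q \<Longrightarrow> D v \<in> Q"
    and skew: "\<And>v y. v \<in> Q \<Longrightarrow> y \<in> Q \<Longrightarrow> \<phi> (D v) y = - \<phi> v (D y)"
    and nil: "\<And>v. v \<in> Q \<Longrightarrow> (D ^^ k) v = 0"
    and v: "v \<in> Q"
  shows "\<phi> (D v) (D v) = 0"
proof -
  have DkQ: "(D ^^ j) v \<in> Q" for j by (induction j) (use v DQ in auto)
  have DkV: "(D ^^ j) v \<in> V" for j using DkQ Q(2) by blast
  have step: "\<phi> ((D ^^ Suc j) v) ((D ^^ Suc j) v) = 0"
    if "\<phi> ((D ^^ Suc (Suc j)) v) ((D ^^ Suc (Suc j)) v) = 0" for j
  proof -
    have "\<phi> ((D ^^ Suc (Suc j)) v) ((D ^^ j) v) = 0"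
      by (rule null_vector_radical[OF Q DkQ DkQ that])
    then show ?thesis
      using skew[OF DkQ DkQ, of j "Suc j"] sym[OF DkV DkV, of j "Suc (Suc j)"] by simp
  qed
  have "\<phi> ((D ^^ Suc j) v) ((D ^^ Suc j) v) = 0 \<Longrightarrow> \<phi> (D v) (D v) = 0" for j
    by (induction j) (use step in auto)
  moreover have "(D ^^ Suc k) v = 0" using nil[OF DQ[OF v]] by (simp only: funpow_Suc_right o_apply)
  ultimately show ?thesis using V_closed(1) form_minus_zero(3)[of 0] by metis
qed

end

section \<open>Forms with a compatible complex structure\<close>

locale hermitian_form = symmetric_form V \<phi>
  for V :: "'a::real_vector set" and \<phi> :: "'a \<Rightarrow> 'a \<Rightarrow> real" +
  fixes J :: "'a \<Rightarrow> 'a"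
  assumes J_closed [simp, intro]: "x \<in> V \<Longrightarrow> J x \<in> V"
    and J_linear: "linear_map_on V J"
    and J_J [simp]: "x \<in> V \<Longrightarrow> J (J x) = - x"
    and J_isometry: "x \<in> V \<Longrightarrow> y \<in> V \<Longrightarrow> \<phi> (J x) (J y) = \<phi> x y"
    and nondegenerate: "x \<in> V \<Longrightarrow> (\<And>y. y \<in> V \<Longrightarrow> \<phi> x y = 0) \<Longrightarrow> x = 0"
    and finite_dimensional: "\<exists>B. finite B \<and> span B = V"
begin

lemma J_add [simp]: "x \<in> V \<Longrightarrow> y \<in> V \<Longrightarrow> J (x + y) = J x + J y"
  and J_scale [simp]: "x \<in> V \<Longrightarrow> J (c *\<^sub>R x) = c *\<^sub>R J x"
  using J_linear unfolding linear_map_on_def by auto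

lemma J_minus [simp]: "x \<in> V \<Longrightarrow> J (- x) = - J x"
  using J_scale[of x "-1"] by simp

lemma J_diff [simp]: "x \<in> V \<Longrightarrow> y \<in> V \<Longrightarrow> J (x - y) = J x - J y"
  using J_add[of x "- y"] by simp

lemma J_zero [simp]: "J 0 = 0"
  using J_scale[of 0 0] by simp

lemma J_left [simp]:
  assumes "x \<in> V" "y \<in> V" shows "\<phi> (J x) y = - \<phi> x (J y)"
  using J_isometry[of "J x" y] assms by simp

lemma J_self [simp]: "x \<in> V \<Longrightarrow> \<phi> x (J x) = 0"
  using J_left[of x x] sym[OF _ J_closed, of x x] by linarith

lemma J_eq_0 [simp]: "x \<in> V \<Longrightarrow> J x = 0 \<longleftrightarrow> x = 0"
  using J_J[of x] by (metis J_zero neg_equal_0_iff_equal)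

text \<open>
  Take an orthogonal set of maximal size that is stable under \<open>J\<close> up to sign. If a vector \<open>x \<noteq> 0\<close> were
  orthogonal to it, so would \<open>J x\<close> be, and adding both would enlarge the set by two elements. Sizes
  are bounded because such sets are independent.
\<close>

lemma unitary_basis_exists:
  assumes pos: "\<And>x. x \<in> V \<Longrightarrow> x \<noteq> 0 \<Longrightarrow> \<phi> x x > 0"
  shows "\<exists>E. orth_basis V \<phi> E \<and> even (card E)"
proof -
  define good where "good E \<longleftrightarrow> finite E \<and> E \<subseteq> V \<and> (\<forall>b\<in>E. \<forall>c\<in>E. b \<noteq> c \<longrightarrow> \<phi> b c = 0) \<and>
    (\<forall>b\<in>E. \<phi> b b \<noteq> 0) \<and> (\<forall>b\<in>E. J b \<in> E \<or> - J b \<in> E) \<and> even (card E)" for E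
  obtain K where K: "finite K" "span K = V" using finite_dimensional by blast
  have bound: "card E \<le> card K" if "good E" for E
  proof -
    have "independent E" using that by (intro orthogonal_independent) (auto simp: good_def)
    moreover have "E \<subseteq> span K" using that K by (simp add: good_def)
    ultimately show ?thesis using independent_span_bound[OF K(1)] by blast
  qed
  have "good {}" by (simp add: good_def)
  then obtain E where E: "good E" and max: "\<And>F. good F \<Longrightarrow> card F \<le> card E"
    using ex_has_greatest_nat[of good "{}" card "Suc (card K)"] bound by (metis le_imp_less_Suc)
  have fE: "finite E" and EV: "\<And>b. b \<in> E \<Longrightarrow> b \<in> V" using E by (auto simp: good_def)
  \<comment> \<open>Maximality makes the orthogonal complement of \<open>E\<close> trivial.\<close>
  have "x = 0" if x: "x \<in> V" and xE: "\<forall>b\<in>E. \<phi> x b = 0" for x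
  proof (rule ccontr)
    assume "x \<noteq> 0"
    then have xx: "\<phi> x x > 0" using pos x by blast
    have JxE: "\<phi> (J x) b = 0" if b: "b \<in> E" for b
    proof -
      have "J b \<in> E \<or> - J b \<in> E" using E b unfolding good_def by simp
      then have "\<phi> x (J b) = 0 \<or> \<phi> x (- J b) = 0" using xE by blast
      then show ?thesis using x EV[OF b] by simp
    qed
    have JJ: "\<phi> (J x) (J x) > 0" using xx x J_isometry by simp
    have xn: "x \<notin> E" using xE xx by auto
    have Jxn: "J x \<notin> E" using JxE JJ by force
    have xJx: "x \<noteq> J x" using J_self[OF x] xx by auto
    let ?F = "insert x (insert (J x) E)"
    have cF: "card ?F = card E + 2" using fE xn Jxn xJx by simp
    have sx: "\<forall>b\<in>E. \<phi> b x = 0" "\<forall>b\<in>E. \<phi> b (J x) = 0"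
      using xE JxE x EV by (metis J_closed sym)+
    have ne: "\<forall>b\<in>?F. \<phi> b b \<noteq> 0" using E xx JJ by (simp add: good_def del: J_left)
    have Jin: "\<forall>b\<in>?F. J b \<in> ?F \<or> - J b \<in> ?F" using E x by (auto simp: good_def)
    have JxJ: "\<phi> (J x) x = 0" using x by simp
    have orth: "\<forall>b\<in>?F. \<forall>c\<in>?F. b \<noteq> c \<longrightarrow> \<phi> b c = 0"
      using E xE JxE sx J_self[OF x] JxJ by (simp add: good_def del: J_left)
    have "good ?F"
      unfolding good_def cF using E x ne Jin orth fE by (simp add: good_def)
    from max[OF this] show False using cF by simp
  qed
  then have "orth_basis V \<phi> E" using E by (auto simp: good_def orth_basis_def)
  then show ?thesis using E by (auto simp: good_def)
qed

text \<open>
  A hyperbolic partner of the complex line through \<open>w\<close>. Nondegeneracy gives a \<open>y\<close> that pairs with \<open>w\<close>;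
  a complex multiple of \<open>y\<close> normalises the pairings with \<open>w\<close> and \<open>J w\<close>, and subtracting a multiple of
  \<open>w\<close> makes it null without changing them.
\<close>

lemma dual_null_vector:
  assumes w: "w \<in> V" "w \<noteq> 0" "\<phi> w w = 0"
  shows "\<exists>u\<in>V. \<phi> u u = 0 \<and> \<phi> u w = 1 \<and> \<phi> u (J w) = 0"
proof -
  obtain y where y: "y \<in> V" "\<phi> w y \<noteq> 0" using nondegenerate w by blast
  define c d where "c = \<phi> y w" and "d = \<phi> y (J w)"
  have "c \<noteq> 0" using y w sym[of w y] by (simp add: c_def)
  define n where "n = c * c + d * d"
  have n: "n \<noteq> 0" using \<open>c \<noteq> 0\<close> by (simp add: n_def sum_squares_eq_zero_iff)
  \<comment> \<open>Dividing \<open>y\<close> by the complex number \<open>c + i d\<close>, with \<open>J\<close> acting as \<open>i\<close>.\<close>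
  define v where "v = (c / n) *\<^sub>R y - (d / n) *\<^sub>R J y"
  have v: "v \<in> V" using y by (simp add: v_def)
  have "\<phi> v w = (c * c + d * d) / n"
    using y w c_def[symmetric] d_def[symmetric] by (simp add: v_def add_divide_distrib)
  then have vw: "\<phi> v w = 1" using n by (simp add: n_def)
  have vJw: "\<phi> v (J w) = 0"
    using y w c_def[symmetric] d_def[symmetric] by (simp add: v_def mult.commute)
  show ?thesis
  proof (intro bexI conjI)
    let ?u = "v - (\<phi> v v / 2) *\<^sub>R w"
    show "\<phi> ?u ?u = 0" using v w vw sym[of w v] by simp
  qed (use v w vw vJw in auto)
qed

end


section \<open>Lorentzian signature\<close>

text \<open>
  The signature enters the argument only in this form: the metric is positive on the orthogonal
  complement of the two negative members of an orthogonal basis, by Parseval's identity.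
\<close>

lemma lorentz_positive_off_plane:
  fixes G :: "'a::real_vector ph_alg"
  assumes "lorentz_hermitian G"
  shows "\<exists>n1\<in>vspace G. \<exists>n2\<in>vspace G. \<forall>x\<in>vspace G.
    metric G x n1 = 0 \<longrightarrow> metric G x n2 = 0 \<longrightarrow> x \<noteq> 0 \<longrightarrow> metric G x x > 0"
proof -
  let ?V = "vspace G" and ?m = "metric G"
  have G: "pseudo_hermitian G" using assms by (simp add: lorentz_hermitian_def)
  interpret symmetric_form ?V ?m
    using G by unfold_locales (auto simp: pseudo_hermitian_def lie_algebra_def)
  obtain B where B: "finite B" "independent B" "span B = ?V"
      "\<forall>b\<in>B. \<forall>c\<in>B. b \<noteq> c \<longrightarrow> ?m b c = 0" "card {b\<in>B. ?m b b < 0} = 2"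
    using assms unfolding lorentz_hermitian_def has_signature_def by blast
  have BV: "\<And>b. b \<in> B \<Longrightarrow> b \<in> ?V" using B(3) span_base by blast
  have orth_all: "x = 0" if x: "x \<in> ?V" and xB: "\<forall>b\<in>B. ?m x b = 0" for x
  proof -
    have "subspace {y\<in>?V. ?m x y = 0}" using x by (auto simp: subspace_def)
    then have "span B \<subseteq> {y\<in>?V. ?m x y = 0}" using xB BV by (intro span_minimal) auto
    then have "\<forall>y\<in>?V. ?m x y = 0" using B(3) by blast
    then show ?thesis using G x unfolding pseudo_hermitian_def by blast
  qed
  \<comment> \<open>A null member of the basis would be orthogonal to everything, contradicting nondegeneracy.\<close>
  have nonnull: "?m b b \<noteq> 0" if b: "b \<in> B" for b
  proof
    assume "?m b b = 0"
    then have "b = 0" using orth_all[OF BV[OF b]] B(4) b by metis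
    then show False using B(2) b dependent_zero by blast
  qed
  have ob: "orth_basis ?V ?m B"
    unfolding orth_basis_def using B(1,4) BV orth_all nonnull by (intro conjI) (blast | simp)+
  obtain n1 n2 where n: "{b\<in>B. ?m b b < 0} = {n1, n2}"
    using B(5) by (meson card_2_iff)
  have "?m x x > 0" if x: "x \<in> ?V" "?m x n1 = 0" "?m x n2 = 0" "x \<noteq> 0" for x
  proof -
    have nn: "(?m x b)\<^sup>2 / ?m b b \<ge> 0" if "b \<in> B" for b
    proof (cases "?m b b < 0")
      case True
      then have "b \<in> {n1, n2}" using n that by blast
      then show ?thesis using x by auto
    qed simp
    obtain b where b: "b \<in> B" "?m x b \<noteq> 0" using orth_all x by blast
    have "b \<notin> {n1, n2}" using b x by auto
    then have "\<not> ?m b b < 0" using n b(1) by blast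
    then have "?m b b > 0" using nonnull[OF b(1)] by linarith
    then have "(?m x b)\<^sup>2 / ?m b b > 0" using b by simp
    then have "0 < (\<Sum>b\<in>B. (?m x b)\<^sup>2 / ?m b b)" by (rule sum_pos2[OF B(1) b(1)]) (rule nn)
    then show ?thesis using orth_basis_form[OF ob x(1)] by simp
  qed
  moreover have "n1 \<in> ?V" "n2 \<in> ?V" using n BV by blast+
  ultimately show ?thesis by (intro bexI[of _ n1] bexI[of _ n2]) auto
qed

lemma two_linear_equations_three_unknowns:
  fixes p q :: "real \<times> real \<times> real"
  obtains a b c :: real where "(a, b, c) \<noteq> (0, 0, 0)"
    "a * fst p + b * fst (snd p) + c * snd (snd p) = 0"
    "a * fst q + b * fst (snd q) + c * snd (snd q) = 0"
proof -
  have "dim {p, q} \<le> card {p, q}" by (rule dim_le_card[OF span_superset]) simp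
  also have "\<dots> \<le> 2" by (simp add: card_insert_if)
  finally have "dim {p, q} < DIM(real \<times> real \<times> real)" by simp
  then obtain x where x: "x \<noteq> 0" "\<And>y. y \<in> span {p, q} \<Longrightarrow> orthogonal x y"
    using orthogonal_to_subspace_exists by blast
  have "orthogonal x p" "orthogonal x q" using x(2) span_base[of _ "{p, q}"] by auto
  with x(1) show ?thesis
    by (intro that[of "fst x" "fst (snd x)" "snd (snd x)"])
      (auto simp: orthogonal_def inner_prod_def zero_prod_def prod_eq_iff algebra_simps)
qed

section \<open>Nilpotent quadratic Lie algebras with a complex structure\<close>

text \<open>
  Nilpotency is recorded as a common bound on the nilpotency indices of the operators \<open>ad x\<close>: this is what
  \<open>skew_nilpotent_null\<close> and the eigenvector argument below draw on.
\<close>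

locale nilpotent_quadratic = hermitian_form V \<phi> J
  for V :: "'a::real_vector set" and \<phi> J +
  fixes br :: "'a \<Rightarrow> 'a \<Rightarrow> 'a"
  assumes br_closed [simp, intro]: "x \<in> V \<Longrightarrow> y \<in> V \<Longrightarrow> br x y \<in> V"
    and br_bilinear: "bilinear_map_on V br"
    and br_self: "x \<in> V \<Longrightarrow> br x x = 0"
    and integrable: "x \<in> V \<Longrightarrow> y \<in> V \<Longrightarrow>
      br x y + J (br (J x) y) + J (br x (J y)) - br (J x) (J y) = 0"
    and invariant: "x \<in> V \<Longrightarrow> y \<in> V \<Longrightarrow> z \<in> V \<Longrightarrow> \<phi> (br x y) z = - \<phi> y (br x z)"
    and ad_nilpotent: "\<exists>k. \<forall>x\<in>V. \<forall>y\<in>V. (br x ^^ k) y = 0"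
begin

lemma br_linear [simp]:
  shows "x \<in> V \<Longrightarrow> y \<in> V \<Longrightarrow> z \<in> V \<Longrightarrow> br (x + y) z = br x z + br y z"
    "x \<in> V \<Longrightarrow> y \<in> V \<Longrightarrow> z \<in> V \<Longrightarrow> br z (x + y) = br z x + br z y"
    "x \<in> V \<Longrightarrow> z \<in> V \<Longrightarrow> br (c *\<^sub>R x) z = c *\<^sub>R br x z"
    "x \<in> V \<Longrightarrow> z \<in> V \<Longrightarrow> br z (c *\<^sub>R x) = c *\<^sub>R br z x"
  using br_bilinear unfolding bilinear_map_on_def linear_map_on_def by auto

lemma br_minus_zero [simp]:
  shows "x \<in> V \<Longrightarrow> z \<in> V \<Longrightarrow> br (- x) z = - br x z"
    "x \<in> V \<Longrightarrow> z \<in> V \<Longrightarrow> br z (- x) = - br z x"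
    "z \<in> V \<Longrightarrow> br 0 z = 0" "z \<in> V \<Longrightarrow> br z 0 = 0"
  using br_linear(3,4)[of x z "-1"] br_linear(3,4)[of 0 z 0] by auto

lemma br_skew:
  assumes "x \<in> V" "y \<in> V" shows "br x y = - br y x"
proof -
  have "br x y + br y x = 0"
    using br_self[of "x + y"] br_self[of x] br_self[of y] assms by (simp add: add.commute)
  then show ?thesis by (simp add: eq_neg_iff_add_eq_0)
qed

declare br_self [simp]

lemma form_br_self [simp]:
  assumes "x \<in> V" "y \<in> V" shows "\<phi> (br x y) x = 0" "\<phi> (br x y) y = 0"
proof -
  show "\<phi> (br x y) x = 0" using invariant[of x y x] assms by simp
  have "\<phi> (br y x) y = 0" using invariant[of y x y] assms by simp
  then show "\<phi> (br x y) y = 0" using br_skew[OF assms] assms by simp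
qed

lemma ad_eigenvalue_zero:
  assumes "x \<in> V" "y \<in> V" "br x y = c *\<^sub>R y" "y \<noteq> 0"
  shows "c = 0"
proof -
  obtain k where k: "(br x ^^ k) y = 0" using ad_nilpotent assms by blast
  have "(br x ^^ j) y = c ^ j *\<^sub>R y" for j
    by (induction j) (use assms in \<open>auto simp: mult.commute\<close>)
  then show ?thesis using k assms(4) by auto
qed

end

section \<open>Lorentzian algebras with a null central vector\<close>

text \<open>
  The vectors \<open>u\<close> and \<open>J u\<close> are dual to the isotropic plane \<open>P\<close> spanned by \<open>w\<close> and \<open>J w\<close>.
\<close>

locale lorentz_null_center = nilpotent_quadratic V \<phi> J br
  for V :: "'a::real_vector set" and \<phi> J br +
  fixes w u :: 'a
  assumes lorentz: "\<exists>n1\<in>V. \<exists>n2\<in>V. \<forall>x\<in>V. \<phi> x n1 = 0 \<longrightarrow> \<phi> x n2 = 0 \<longrightarrow> x \<noteq> 0 \<longrightarrow> \<phi> x x > 0"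
    and w_V [simp]: "w \<in> V" and w_null [simp]: "\<phi> w w = 0"
    and w_central: "x \<in> V \<Longrightarrow> br x w = 0"
    and u_V [simp]: "u \<in> V" and u_null [simp]: "\<phi> u u = 0"
    and u_w [simp]: "\<phi> u w = 1" and u_Jw [simp]: "\<phi> u (J w) = 0"
begin

text \<open>
  \<open>Q = P\<^sup>\<bottom>\<close> contains \<open>P\<close>, because \<open>P\<close> is isotropic, and \<open>P\<close> is the radical of \<open>\<phi>\<close> on \<open>Q\<close>.
\<close>

definition Q :: "'a set" where "Q = {v\<in>V. \<phi> v w = 0 \<and> \<phi> v (J w) = 0}"

lemma w_nonzero: "w \<noteq> 0" using u_w form_minus_zero(4)[OF u_V] by (metis zero_neq_one)

lemma w_u [simp]: "\<phi> w u = 1" "\<phi> w (J u) = 0"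
  using sym[of w u] sym[of w "J u"] by auto

lemma Q_I: "v \<in> V \<Longrightarrow> \<phi> v w = 0 \<Longrightarrow> \<phi> v (J w) = 0 \<Longrightarrow> v \<in> Q"
  by (simp add: Q_def)

lemma subspace_Q: "subspace Q" unfolding subspace_def Q_def by auto

lemma Q_D [simp]: "v \<in> Q \<Longrightarrow> v \<in> V" "v \<in> Q \<Longrightarrow> \<phi> v w = 0" "v \<in> Q \<Longrightarrow> \<phi> v (J w) = 0"
  by (simp_all add: Q_def)

lemma J_Q [simp]: "v \<in> Q \<Longrightarrow> J v \<in> Q" by (rule Q_I) auto

text \<open>
  The plane \<open>P\<close> is a maximal subspace on which \<open>\<phi>\<close> is negative semidefinite. In fact
  \<open>w\<close>, \<open>J w\<close>, \<open>v\<close> are mutually orthogonal without positive squares, and two linear equations in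
  three unknowns have a nontrivial solution: some combination of them with nontrivial coefficients is
  orthogonal to both negative directions of \<open>\<phi>\<close>. Having a nonpositive square, it must vanish, and
  this is the asserted linear relation.
\<close>

lemma nonpositive_in_plane:
  assumes v: "v \<in> Q" and vv: "\<phi> v v \<le> 0"
  shows "v = \<phi> v u *\<^sub>R w + \<phi> v (J u) *\<^sub>R J w"
proof -
  have vV: "v \<in> V" and vw: "\<phi> v w = 0" "\<phi> v (J w) = 0" using v by simp_all
  have wv: "\<phi> w v = 0" "\<phi> w (J v) = 0" using vV vw sym[of w v] sym[of w "J v"] by auto
  obtain n1 n2 where n: "n1 \<in> V" "n2 \<in> V"
      and pos: "\<And>x. x \<in> V \<Longrightarrow> \<phi> x n1 = 0 \<Longrightarrow> \<phi> x n2 = 0 \<Longrightarrow> x \<noteq> 0 \<Longrightarrow> \<phi> x x > 0"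
    using lorentz by blast
  obtain a b c where abc: "(a, b, c) \<noteq> (0, 0, 0)"
      "a * \<phi> w n1 + b * \<phi> (J w) n1 + c * \<phi> v n1 = 0"
      "a * \<phi> w n2 + b * \<phi> (J w) n2 + c * \<phi> v n2 = 0"
    using two_linear_equations_three_unknowns[of "(\<phi> w n1, \<phi> (J w) n1, \<phi> v n1)" "(\<phi> w n2, \<phi> (J w) n2, \<phi> v n2)"]
    by (metis fst_conv snd_conv)
  define x where "x = a *\<^sub>R w + b *\<^sub>R J w + c *\<^sub>R v"
  have xV: "x \<in> V" using vV by (simp add: x_def)
  have "\<phi> x n1 = 0" "\<phi> x n2 = 0" using abc(2,3) n vV by (simp_all add: x_def)
  moreover have "\<phi> x x = c * (c * \<phi> v v)" using vV vw wv by (simp add: x_def algebra_simps)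
  moreover have "c * (c * \<phi> v v) \<le> 0"
    using vv by (metis mult.assoc mult_nonneg_nonpos zero_le_square)
  ultimately have x0: "x = 0" using pos[OF xV] by fastforce
  \<comment> \<open>Pairing the relation with \<open>u\<close> and \<open>J u\<close> identifies its coefficients.\<close>
  have xu: "\<phi> x u = 0" "\<phi> x (J u) = 0" by (simp_all add: x0)
  then have ab: "a = - c * \<phi> v u" "b = - c * \<phi> v (J u)" using vV by (simp_all add: x_def)
  have "c \<noteq> 0" using abc(1) ab by auto
  have "c *\<^sub>R (v - (\<phi> v u *\<^sub>R w + \<phi> v (J u) *\<^sub>R J w)) = x"
    by (simp add: x_def ab algebra_simps)
  then show ?thesis using x0 \<open>c \<noteq> 0\<close> by auto
qed

lemma Q_null_or_positive:
  assumes "v \<in> Q" shows "\<phi> v v \<ge> 0"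
proof (rule ccontr)
  assume neg: "\<not> \<phi> v v \<ge> 0"
  then have "v = \<phi> v u *\<^sub>R w + \<phi> v (J u) *\<^sub>R J w" using assms by (intro nonpositive_in_plane) auto
  then have "\<phi> v v = \<phi> v (\<phi> v u *\<^sub>R w + \<phi> v (J u) *\<^sub>R J w)" by simp
  also have "\<dots> = 0" using assms by simp
  finally show False using neg by simp
qed

lemma br_w [simp]: "x \<in> V \<Longrightarrow> br x w = 0" "x \<in> V \<Longrightarrow> br w x = 0"
  using w_central br_skew[of w x] by auto

lemma br_form_w [simp]: "x \<in> V \<Longrightarrow> y \<in> V \<Longrightarrow> \<phi> (br x y) w = 0"
  using invariant[of x y w] by simp

lemma V_decomposition:
  assumes "y \<in> V"
  obtains q where "q \<in> Q" "y = \<phi> y w *\<^sub>R u + \<phi> y (J w) *\<^sub>R J u + q"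
proof
  let ?q = "y - (\<phi> y w *\<^sub>R u + \<phi> y (J w) *\<^sub>R J u)"
  show "y = \<phi> y w *\<^sub>R u + \<phi> y (J w) *\<^sub>R J u + ?q" by simp
  show "?q \<in> Q" using assms by (intro Q_I) simp_all
qed

text \<open>
  On \<open>Q\<close> the form is positive semidefinite and \<open>ad x\<close> is skew and nilpotent, so \<open>[x, v]\<close> is null, that is,
  in \<open>P\<close>.
\<close>

lemma ad_null_in_plane:
  assumes D: "x \<in> V" "\<And>v. v \<in> Q \<Longrightarrow> br x v \<in> Q" and v: "v \<in> Q"
  shows "br x v = \<phi> (br x v) u *\<^sub>R w + \<phi> (br x v) (J u) *\<^sub>R J w"
proof (rule nonpositive_in_plane)
  obtain k where k: "\<forall>y\<in>V. (br x ^^ k) y = 0" using ad_nilpotent D by blast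
  have "\<phi> (br x v) (br x v) = 0"
    using subspace_Q _ Q_null_or_positive D(2) _ _ v
    by (rule skew_nilpotent_null[where k = k]) (use D k in \<open>auto intro: invariant\<close>)
  then show "\<phi> (br x v) (br x v) \<le> 0" by simp
qed (use D v in auto)

text \<open>
  This is where integrability is used: as \<open>w\<close> is central, it reduces to \<open>D J = J D\<close> for
  \<open>D = ad (J w)\<close>. The vector \<open>q = D u\<close> controls \<open>D\<close> completely. It is null because otherwise \<open>J w\<close>
  would be an eigenvector of \<open>ad (J q)\<close> with eigenvalue \<open>\<phi>(q,q) \<noteq> 0\<close>; so it lies in \<open>P\<close> and is in fact a
  multiple of \<open>J w\<close>, which makes \<open>J w\<close> an eigenvector of \<open>ad u\<close>. A second appeal to nilpotency gives
  \<open>q = 0\<close>.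
\<close>

lemma Jw_central:
  assumes "y \<in> V" shows "br (J w) y = 0"
proof -
  define D where "D = br (J w)"
  have DV [simp]: "D x \<in> V" if "x \<in> V" for x using that by (simp add: D_def)
  have DJ: "D (J x) = J (D x)" if "x \<in> V" for x
    using integrable[OF w_V that] that by (simp add: D_def)
  have skew: "\<phi> (D x) z = - \<phi> x (D z)" if "x \<in> V" "z \<in> V" for x z
    using that by (simp add: D_def invariant)
  have D_Q: "D x \<in> Q" if "x \<in> V" for x using that invariant[of "J w" x "J w"] by (intro Q_I) (simp_all add: D_def)
  have plane: "D v = \<phi> (D v) u *\<^sub>R w + \<phi> (D v) (J u) *\<^sub>R J w" if "v \<in> Q" for v
    unfolding D_def using that D_Q by (intro ad_null_in_plane) (auto simp: D_def)
  define q where "q = D u"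
  have q: "q \<in> Q" "q \<in> V" using D_Q by (simp_all add: q_def)
  have "\<phi> (D q) u = - \<phi> q q" using skew[of q u] q by (simp add: q_def)
  moreover have "\<phi> (D q) (J u) = 0" using skew[of q "J u"] q DJ[of u] by (simp add: q_def)
  ultimately have "D q = - \<phi> q q *\<^sub>R w" using plane[OF q(1)] by simp
  then have "D (J q) = - \<phi> q q *\<^sub>R J w" using DJ[OF q(2)] by simp
  then have "br (J q) (J w) = \<phi> q q *\<^sub>R J w"
    using br_skew[of "J q" "J w"] q by (simp add: D_def)
  then have "\<phi> q q = 0" using ad_eigenvalue_zero[of "J q" "J w" "\<phi> q q"] q w_nonzero by simp
  then have "q = \<phi> q u *\<^sub>R w + \<phi> q (J u) *\<^sub>R J w" using q by (intro nonpositive_in_plane) auto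
  moreover have "\<phi> q u = 0" by (simp add: q_def D_def)
  ultimately have "D u = \<phi> q (J u) *\<^sub>R J w" by (simp add: q_def)
  then have "br u (J w) = (- \<phi> q (J u)) *\<^sub>R J w"
    using br_skew[of u "J w"] by (simp add: D_def)
  then have "- \<phi> q (J u) = 0"
    using ad_eigenvalue_zero[of u "J w" "- \<phi> q (J u)"] w_nonzero by simp
  then have Du: "D u = 0" using \<open>D u = _\<close> by simp
  then have DJu: "D (J u) = 0" using DJ[of u] by simp
  obtain v where v: "v \<in> Q" and y: "y = \<phi> y w *\<^sub>R u + \<phi> y (J w) *\<^sub>R J u + v"
    using V_decomposition[OF assms] .
  \<comment> \<open>The two coefficients of \<open>D v\<close> in \<open>P\<close> are, by skewness, pairings of \<open>v\<close> with \<open>D u = D (J u) = 0\<close>.\<close>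
  have "D v = 0" using plane[OF v] skew[of v u] skew[of v "J u"] v Du DJu by simp
  have "br (J w) y = br (J w) (\<phi> y w *\<^sub>R u + \<phi> y (J w) *\<^sub>R J u + v)" using y by simp
  also have "\<dots> = 0" using v Du DJu \<open>D v = 0\<close> by (simp add: D_def)
  finally show ?thesis .
qed

text \<open>
  Brackets are orthogonal to the centre, which now contains \<open>P\<close>.
\<close>

lemma br_in_Q [simp]: "x \<in> V \<Longrightarrow> y \<in> V \<Longrightarrow> br x y \<in> Q"
  using invariant[of x y "J w"] Jw_central[of x] br_skew[of x "J w"] by (intro Q_I) simp_all

lemma br_V_Q:
  assumes "x \<in> V" "v \<in> Q"
  shows "br x v = \<phi> (br x v) u *\<^sub>R w + \<phi> (br x v) (J u) *\<^sub>R J w"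
  using assms by (intro ad_null_in_plane) auto

text \<open>
  The values lie in \<open>P\<close> by \<open>br_V_Q\<close>; their coefficients are the pairings with \<open>u\<close> and \<open>J u\<close>, which
  invariance moves onto \<open>[u, J u]\<close>.
\<close>

lemma br_u_Q:
  assumes "v \<in> Q"
  shows "br u v = - \<phi> v (br u (J u)) *\<^sub>R J w" "br (J u) v = \<phi> v (br u (J u)) *\<^sub>R w"
proof -
  have "\<phi> (br u v) (J u) = - \<phi> v (br u (J u))" using assms by (intro invariant) auto
  then show "br u v = - \<phi> v (br u (J u)) *\<^sub>R J w" using br_V_Q[of u v] assms by simp
  have "\<phi> (br (J u) v) u = - \<phi> v (br (J u) u)" using assms by (intro invariant) auto
  then have "\<phi> (br (J u) v) u = \<phi> v (br u (J u))" using br_skew[of "J u" u] assms by simp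
  then show "br (J u) v = \<phi> v (br u (J u)) *\<^sub>R w" using br_V_Q[of "J u" v] assms by simp
qed

text \<open>
  Again the coefficients in \<open>P\<close> become, by invariance, pairings of \<open>v'\<close> with the brackets of \<open>v\<close> with
  \<open>u\<close> and \<open>J u\<close>; those lie in \<open>P\<close>, and \<open>v'\<close> is orthogonal to \<open>P\<close>.
\<close>

lemma br_Q_Q:
  assumes "v \<in> Q" "v' \<in> Q" shows "br v v' = 0"
proof -
  have orth: "\<phi> v' w = 0" "\<phi> v' (J w) = 0" using assms by simp_all
  have "\<phi> (br v v') u = 0"
    using invariant[of v v' u] br_skew[of v u] br_u_Q(1)[of v] assms orth by simp
  moreover have "\<phi> (br v v') (J u) = 0"
    using invariant[of v v' "J u"] br_skew[of v "J u"] br_u_Q(2)[of v] assms orth by simp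
  ultimately show ?thesis using br_V_Q[of v v'] assms by simp
qed

text \<open>
  The bracket of \<open>\<L>\<close> before normalisation, in terms of the decomposition of \<open>V\<close> into the span of \<open>u\<close>,
  \<open>J u\<close> and the subspace \<open>Q\<close>.
\<close>

lemma br_formula:
  fixes y y' :: 'a
  assumes "y \<in> V" "y' \<in> V"
  defines "z \<equiv> br u (J u)"
  shows "br y y' = (\<phi> y w * \<phi> y' (J w) - \<phi> y' w * \<phi> y (J w)) *\<^sub>R z
    - (\<phi> y w * \<phi> y' z - \<phi> y' w * \<phi> y z) *\<^sub>R J w
    + (\<phi> y (J w) * \<phi> y' z - \<phi> y' (J w) * \<phi> y z) *\<^sub>R w"
proof -
  have zV: "z \<in> V" by (simp add: z_def)
  have uz: "\<phi> u z = 0" "\<phi> (J u) z = 0"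
    using sym[OF u_V zV] sym[of "J u" z] zV by (simp_all add: z_def del: J_left)
  obtain q where q: "q \<in> Q" and y: "y = \<phi> y w *\<^sub>R u + \<phi> y (J w) *\<^sub>R J u + q"
    using V_decomposition[OF assms(1)] .
  obtain q' where q': "q' \<in> Q" and y': "y' = \<phi> y' w *\<^sub>R u + \<phi> y' (J w) *\<^sub>R J u + q'"
    using V_decomposition[OF assms(2)] .
  define a b a' b' where ab: "a = \<phi> y w" "b = \<phi> y (J w)" "a' = \<phi> y' w" "b' = \<phi> y' (J w)"
  note y = y[folded ab] and y' = y'[folded ab]
  have "\<phi> y z = \<phi> q z" "\<phi> y' z = \<phi> q' z"
    unfolding y y' using q q' uz zV by (simp_all del: J_left)
  moreover have "br y y' = (a * b' - a' * b) *\<^sub>R z - (a * \<phi> q' z - a' * \<phi> q z) *\<^sub>R J w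
      + (b * \<phi> q' z - b' * \<phi> q z) *\<^sub>R w"
    unfolding y y' using q q' br_u_Q[OF q] br_u_Q[OF q'] br_Q_Q[OF q q']
      br_skew[of q u] br_skew[of q "J u"] br_skew[of "J u" u]
    by (simp add: z_def[symmetric] algebra_simps)
  ultimately show ?thesis by (simp add: ab)
qed

text \<open>
  If \<open>z = [u, J u]\<close> were not positive it would lie in \<open>P\<close>, but \<open>z\<close> is orthogonal to \<open>u\<close> and \<open>J u\<close>; so \<open>z\<close>
  would vanish, and with it the whole bracket by \<open>br_formula\<close>.
\<close>

lemma br_z_positive:
  assumes "x \<in> V" "x' \<in> V" "br x x' \<noteq> 0"
  shows "\<phi> (br u (J u)) (br u (J u)) > 0"
proof (rule ccontr)
  let ?z = "br u (J u)"
  assume "\<not> \<phi> ?z ?z > 0"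
  then have "?z = \<phi> ?z u *\<^sub>R w + \<phi> ?z (J u) *\<^sub>R J w" by (intro nonpositive_in_plane) auto
  then have "?z = 0" by (simp del: J_left)
  then show False using br_formula[OF assms(1,2)] assms by simp
qed

end

section \<open>Splitting off the six-dimensional algebra\<close>

lemma L_vec_eqI:
  fixes c d :: "real ^ L_index"
  assumes "c $ X1 = d $ X1" "c $ JX1 = d $ JX1" "c $ X2 = d $ X2" "c $ JX2 = d $ JX2"
    "c $ X3 = d $ X3" "c $ JX3 = d $ JX3"
  shows "c = d"
  unfolding vec_eq_iff
proof
  fix i show "c $ i = d $ i" using assms by (cases i) auto
qed

text \<open>
  Vectors \<open>x\<^sub>1\<close>, \<open>x\<^sub>2\<close>, \<open>x\<^sub>3\<close> with the Gram matrix of the algebra \<open>\<L>\<close>, such that the bracket of any two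
  vectors depends only on their pairings with the frame, as in \<open>\<L>\<close>, and such that the metric is
  positive definite on the complement. These data amount to a splitting of \<open>V\<close> as in the theorem. Since \<open>x\<^sub>1\<close> and
  \<open>x\<^sub>3\<close> are dual to each other, the coordinate of a vector along \<open>x\<^sub>1\<close> is its pairing with \<open>x\<^sub>3\<close> and vice
  versa.
\<close>

locale L_frame = hermitian_form V \<phi> J
  for V :: "'a::real_vector set" and \<phi> J +
  fixes br :: "'a \<Rightarrow> 'a \<Rightarrow> 'a" and x1 x2 x3 :: 'a
  assumes frame_V [simp]: "x1 \<in> V" "x2 \<in> V" "x3 \<in> V"
    and frame_gram [simp]:
      "\<phi> x1 x1 = 0" "\<phi> x1 x2 = 0" "\<phi> x1 x3 = 1" "\<phi> x2 x2 = 1" "\<phi> x3 x2 = 0" "\<phi> x3 x3 = 0"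
      "\<phi> x1 (J x2) = 0" "\<phi> x1 (J x3) = 0" "\<phi> x3 (J x2) = 0"
    and frame_br: "y \<in> V \<Longrightarrow> y' \<in> V \<Longrightarrow> br y y' =
      (\<phi> y x3 * \<phi> y' (J x3) - \<phi> y (J x3) * \<phi> y' x3) *\<^sub>R x2
      - (\<phi> y x3 * \<phi> y' x2 - \<phi> y x2 * \<phi> y' x3) *\<^sub>R J x3
      + (\<phi> y (J x3) * \<phi> y' x2 - \<phi> y x2 * \<phi> y' (J x3)) *\<^sub>R x3"
    and frame_complement_positive: "a \<in> V \<Longrightarrow> a \<noteq> 0 \<Longrightarrow>
      (\<And>x. x \<in> {x1, x2, x3} \<Longrightarrow> \<phi> a x = 0 \<and> \<phi> a (J x) = 0) \<Longrightarrow> \<phi> a a > 0"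
begin

lemma frame_gram' [simp]:
  "\<phi> x2 x1 = 0" "\<phi> x3 x1 = 1" "\<phi> x2 x3 = 0"
  "\<phi> x2 (J x1) = 0" "\<phi> x3 (J x1) = 0" "\<phi> x2 (J x3) = 0"
  using sym[of x2 x1] sym[of x3 x1] sym[of x2 x3] sym[of x2 "J x1"] sym[of x3 "J x1"] sym[of x2 "J x3"]
  by simp_all

definition coord :: "'a \<Rightarrow> real ^ L_index" where
  "coord y = (\<chi> i. case i of X1 \<Rightarrow> \<phi> y x3 | JX1 \<Rightarrow> \<phi> y (J x3) | X2 \<Rightarrow> \<phi> y x2
     | JX2 \<Rightarrow> \<phi> y (J x2) | X3 \<Rightarrow> \<phi> y x1 | JX3 \<Rightarrow> \<phi> y (J x1))"

definition of_coord :: "real ^ L_index \<Rightarrow> 'a" where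
  "of_coord c = c $ X1 *\<^sub>R x1 + c $ JX1 *\<^sub>R J x1 + c $ X2 *\<^sub>R x2 + c $ JX2 *\<^sub>R J x2
     + c $ X3 *\<^sub>R x3 + c $ JX3 *\<^sub>R J x3"

definition perp :: "'a set" where "perp = {a\<in>V. coord a = 0}"

lemma coord_nth [simp]:
  "coord y $ X1 = \<phi> y x3" "coord y $ JX1 = \<phi> y (J x3)" "coord y $ X2 = \<phi> y x2"
  "coord y $ JX2 = \<phi> y (J x2)" "coord y $ X3 = \<phi> y x1" "coord y $ JX3 = \<phi> y (J x1)"
  by (simp_all add: coord_def)

lemma of_coord_V [simp]: "of_coord c \<in> V" by (simp add: of_coord_def)

lemma coord_of_coord [simp]: "coord (of_coord c) = c"
  by (rule L_vec_eqI) (simp_all add: of_coord_def)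

lemma coord_linear [simp]:
  "x \<in> V \<Longrightarrow> y \<in> V \<Longrightarrow> coord (x + y) = coord x + coord y"
  "x \<in> V \<Longrightarrow> y \<in> V \<Longrightarrow> coord (x - y) = coord x - coord y"
  "x \<in> V \<Longrightarrow> coord (r *\<^sub>R x) = r *\<^sub>R coord x" "coord 0 = 0"
  by (rule L_vec_eqI; simp)+

lemma coord_J [simp]: "y \<in> V \<Longrightarrow> coord (J y) = cplx L_alg (coord y)"
  by (rule L_vec_eqI) (simp_all add: L_alg_def axis_def)

lemma of_coord_linear:
  "of_coord (c + d) = of_coord c + of_coord d" "of_coord (r *\<^sub>R c) = r *\<^sub>R of_coord c" "of_coord 0 = 0"
  "of_coord (cplx L_alg c) = J (of_coord c)"
  by (simp_all add: of_coord_def L_alg_def axis_def algebra_simps)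

lemma form_of_coord: "y \<in> V \<Longrightarrow> \<phi> (of_coord c) y = metric L_alg c (coord y)"
  by (simp add: of_coord_def L_alg_def sprod_def sym[of y] algebra_simps)

text \<open>
  The bracket factors through the coordinates and takes its values in the copy of \<open>\<L>\<close>. This gives both
  that the complement is an abelian ideal and that the coordinate map is a homomorphism.
\<close>

lemma br_of_coord:
  "y \<in> V \<Longrightarrow> y' \<in> V \<Longrightarrow> br y y' = of_coord (bracket L_alg (coord y) (coord y'))"
  by (simp add: frame_br of_coord_def L_alg_def wedge_def axis_def algebra_simps)

lemma perp_V [simp]: "a \<in> perp \<Longrightarrow> a \<in> V" and perp_coord [simp]: "a \<in> perp \<Longrightarrow> coord a = 0"
  by (simp_all add: perp_def)

lemma subspace_perp: "subspace perp" unfolding subspace_def perp_def by simp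

lemma J_perp: "a \<in> perp \<Longrightarrow> J a \<in> perp"
  unfolding perp_def by (simp add: L_alg_def)

lemma br_perp: "a \<in> perp \<Longrightarrow> b \<in> perp \<Longrightarrow> br a b = 0"
  by (simp add: br_of_coord of_coord_linear L_alg_def wedge_def)

lemma perp_positive:
  assumes "a \<in> perp" "a \<noteq> 0" shows "\<phi> a a > 0"
proof (rule frame_complement_positive)
  fix x assume "x \<in> {x1, x2, x3}"
  moreover have "coord a $ i = 0" for i using perp_coord[OF assms(1)] by simp
  from this[of X1] this[of JX1] this[of X2] this[of JX2] this[of X3] this[of JX3]
  have "\<phi> a x1 = 0" "\<phi> a (J x1) = 0" "\<phi> a x2 = 0" "\<phi> a (J x2) = 0" "\<phi> a x3 = 0" "\<phi> a (J x3) = 0"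
    unfolding coord_nth by simp_all
  ultimately show "\<phi> a x = 0 \<and> \<phi> a (J x) = 0" by auto
qed (use assms in auto)

lemma residual_perp: "y \<in> V \<Longrightarrow> y - of_coord (coord y) \<in> perp"
  unfolding perp_def by simp

definition perp_alg :: "'a ph_alg" where
  "perp_alg = \<lparr>vspace = perp, bracket = br, cplx = J, metric = \<phi>\<rparr>"

lemma perp_alg_hermitian_abelian: "hermitian perp_alg" "abelian perp_alg"
proof -
  have fin: "\<exists>B. finite B \<and> span B = perp"
  proof -
    obtain K where K: "finite K" "span K = V" using finite_dimensional by blast
    obtain B where B: "B \<subseteq> perp" "independent B" "perp \<subseteq> span B"
      using maximal_independent_subset by blast
    have "finite B" using independent_span_bound[OF K(1) B(2)] B(1) K(2) perp_V by blast
    moreover have "span B = perp" using B span_minimal[OF B(1) subspace_perp] by blast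
    ultimately show ?thesis by blast
  qed
  have "lie_algebra perp br"
    using fin subspace_perp subspace_0[OF subspace_perp] br_perp
    by (simp add: lie_algebra_def bilinear_map_on_def linear_map_on_def subspace_add subspace_scale)
  moreover have "complex_structure perp br J"
    using br_perp J_perp by (simp add: complex_structure_def linear_map_on_def)
  moreover have "bilinear_map_on perp \<phi>" by (simp add: bilinear_map_on_def linear_map_on_def)
  moreover have "\<forall>x\<in>perp. \<forall>y\<in>perp. \<phi> x y = \<phi> y x" using sym by auto
  moreover have "\<forall>x\<in>perp. (\<forall>y\<in>perp. \<phi> x y = 0) \<longrightarrow> x = 0" using perp_positive by (metis less_irrefl)
  moreover have "\<forall>x\<in>perp. \<forall>y\<in>perp. \<phi> (J x) (J y) = \<phi> x y" by simp
  ultimately have "pseudo_hermitian perp_alg"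
    unfolding pseudo_hermitian_def perp_alg_def ph_alg.simps by - (intro conjI; assumption)
  then show "hermitian perp_alg" using perp_positive by (simp add: hermitian_def perp_alg_def)
  show "abelian perp_alg" using br_perp by (simp add: abelian_def perp_alg_def)
qed

text \<open>
  The isomorphism is the orthogonal splitting: a vector goes to its component orthogonal to the frame,
  together with its frame coordinates.
\<close>

lemma equivalent_orth_sum:
  "equivalent \<lparr>vspace = V, bracket = br, cplx = J, metric = \<phi>\<rparr> (orth_sum perp_alg L_alg)"
proof -
  let ?H = "orth_sum perp_alg L_alg"
  have H: "vspace ?H = perp \<times> UNIV"
    "bracket ?H u v = (br (fst u) (fst v), bracket L_alg (snd u) (snd v))"
    "cplx ?H u = (J (fst u), cplx L_alg (snd u))"
    "metric ?H u v = \<phi> (fst u) (fst v) + metric L_alg (snd u) (snd v)" for u v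
    by (simp_all add: orth_sum_def perp_alg_def L_alg_def)
  define f where "f y = (y - of_coord (coord y), coord y)" for y
  have "linear_map_on V f" by (simp add: linear_map_on_def f_def of_coord_linear algebra_simps)
  moreover have "bij_betw f V (perp \<times> UNIV)"
  proof (rule bij_betw_byWitness[where f' = "\<lambda>(a, c). a + of_coord c"])
    show "f ` V \<subseteq> perp \<times> UNIV" using residual_perp by (auto simp: f_def)
  qed (auto simp: f_def)
  moreover have "f (br y y') = bracket ?H (f y) (f y')" if "y \<in> V" "y' \<in> V" for y y'
  proof -
    have "br (y - of_coord (coord y)) (y' - of_coord (coord y')) = 0"
      using that by (intro br_perp residual_perp)
    then show ?thesis using that by (simp add: f_def H br_of_coord)
  qed
  moreover have "f (J y) = cplx ?H (f y)" if "y \<in> V" for y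
    using that by (simp add: f_def H of_coord_linear)
  moreover have "metric ?H (f y) (f y') = \<phi> y y'" if "y \<in> V" "y' \<in> V" for y y'
  proof -
    let ?m = "metric L_alg (coord y) (coord y')"
    have "\<phi> (of_coord (coord y)) y' = ?m" "\<phi> (of_coord (coord y)) (of_coord (coord y')) = ?m"
      using that by (simp_all add: form_of_coord)
    moreover have "\<phi> y (of_coord (coord y')) = ?m"
      using that form_of_coord[of y "coord y'"] sym[of y "of_coord (coord y')"]
      by (simp add: L_alg_def sprod_def algebra_simps)
    ultimately show ?thesis using that by (simp add: f_def H)
  qed
  ultimately show ?thesis
    unfolding equivalent_def H(1) by (intro exI[of _ f]) simp
qed

end

text \<open>
  The frame is \<open>s u\<close>, \<open>s\<^sup>2 z\<close>, \<open>s\<^sup>-\<^sup>1 w\<close> with \<open>z = [u, J u]\<close>. These weights preserve the pairing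
  of \<open>x\<^sub>1\<close> with \<open>x\<^sub>3\<close> and the relation \<open>[x\<^sub>1, J x\<^sub>1] = x\<^sub>2\<close>; requiring a unit square of \<open>x\<^sub>2\<close> fixes \<open>s\<close> by
  \<open>s\<^sup>4 \<phi>(z,z) = 1\<close>.
\<close>

lemma (in lorentz_null_center) L_frame_exists:
  assumes "x \<in> V" "x' \<in> V" "br x x' \<noteq> 0"
  shows "\<exists>x1 x2 x3. L_frame V \<phi> J br x1 x2 x3"
proof -
  define z where "z = br u (J u)"
  have z: "z \<in> Q" "z \<in> V" by (simp_all add: z_def)
  define t where "t = \<phi> z z"
  have t: "t > 0" using br_z_positive[OF assms] by (simp add: z_def t_def)
  define s where "s = root 4 (1 / t)"
  have s: "s > 0" using t by (simp add: s_def)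
  have s4: "s ^ 4 * t = 1" using t by (simp add: s_def)
  have uz: "\<phi> u z = 0" "\<phi> u (J z) = 0"
    using sym[OF u_V z(2)] sym[of "J u" z] z by (simp_all add: z_def)
  have wz: "\<phi> w z = 0" "\<phi> w (J z) = 0"
    using sym[OF w_V z(2)] sym[of w "J z"] z by simp_all
  let ?x1 = "s *\<^sub>R u" and ?x2 = "s\<^sup>2 *\<^sub>R z" and ?x3 = "(1 / s) *\<^sub>R w"
  have "L_frame V \<phi> J br ?x1 ?x2 ?x3"
  proof
    show "\<phi> ?x2 ?x2 = 1" using s4 z by (simp add: t_def power_numeral_reduce algebra_simps)
    fix y y' assume y: "y \<in> V" "y' \<in> V"
    show "br y y' =
      (\<phi> y ?x3 * \<phi> y' (J ?x3) - \<phi> y (J ?x3) * \<phi> y' ?x3) *\<^sub>R ?x2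
      - (\<phi> y ?x3 * \<phi> y' ?x2 - \<phi> y ?x2 * \<phi> y' ?x3) *\<^sub>R J ?x3
      + (\<phi> y (J ?x3) * \<phi> y' ?x2 - \<phi> y ?x2 * \<phi> y' (J ?x3)) *\<^sub>R ?x3"
      using br_formula[OF y] y z s unfolding z_def[symmetric]
      by (simp add: power2_eq_square algebra_simps)
  next
    fix a assume a: "a \<in> V" "a \<noteq> 0"
      and orth: "\<And>x. x \<in> {?x1, ?x2, ?x3} \<Longrightarrow> \<phi> a x = 0 \<and> \<phi> a (J x) = 0"
    have au: "\<phi> a u = 0" "\<phi> a (J u) = 0" using orth[of ?x1] a s by auto
    have "a \<in> Q" using orth[of ?x3] a s by (intro Q_I) auto
    show "\<phi> a a > 0"
    proof (rule ccontr)
      assume "\<not> \<phi> a a > 0"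
      then have "a = \<phi> a u *\<^sub>R w + \<phi> a (J u) *\<^sub>R J w" using \<open>a \<in> Q\<close> by (intro nonpositive_in_plane) auto
      then show False using au a by simp
    qed
  qed (use z s uz wz in simp_all)
  then show ?thesis by blast
qed

section \<open>From Lorentzian signature to the orthogonal sum\<close>

lemma ad_power_in_lower_central:
  assumes "x \<in> vspace G" "y \<in> vspace G"
  shows "(bracket G x ^^ k) y \<in> lower_central G k"
proof (induction k)
  case (Suc k)
  then show ?case using assms by (auto intro!: span_base)
qed (use assms in simp)

lemma nilpotent_quadratic_of:
  assumes "pseudo_hermitian_quadratic G" "nilpotent G"
  shows "nilpotent_quadratic (vspace G) (metric G) (cplx G) (bracket G)"
proof -
  have "\<exists>k. \<forall>x\<in>vspace G. \<forall>y\<in>vspace G. (bracket G x ^^ k) y = 0"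
    using assms(2) ad_power_in_lower_central[of _ G] unfolding nilpotent_def by (metis singletonD)
  then show ?thesis
    using assms(1)
    unfolding pseudo_hermitian_quadratic_def pseudo_hermitian_def lie_algebra_def complex_structure_def
    by unfold_locales (auto simp: eq_neg_iff_add_eq_0)
qed

text \<open>
  Since \<open>G\<close> is not abelian, the last nonzero term of its lower central series has index at least one. It
  is central and consists of sums of brackets; by invariance a central vector is orthogonal to every
  bracket, in particular to itself.
\<close>

lemma central_null_vector_exists:
  assumes "pseudo_hermitian_quadratic G" "nilpotent G" "\<not> abelian G"
  shows "\<exists>w\<in>vspace G. w \<noteq> 0 \<and> metric G w w = 0 \<and> (\<forall>x\<in>vspace G. bracket G x w = 0)"
proof -
  interpret nilpotent_quadratic "vspace G" "metric G" "cplx G" "bracket G"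
    using nilpotent_quadratic_of assms by blast
  let ?V = "vspace G" and ?C = "lower_central G"
  have CV: "?C k \<subseteq> ?V" for k
  proof (induction k)
    case (Suc k)
    then have "{bracket G x y | x y. x \<in> ?V \<and> y \<in> ?C k} \<subseteq> ?V" by auto
    then show ?case using span_minimal[OF _ subspace_V] by simp
  qed simp
  have C1: "?C (Suc k) \<subseteq> ?C 1" for k
    unfolding One_nat_def lower_central.simps using CV[of k] by (intro span_mono) blast
  obtain a b where ab: "a \<in> ?V" "b \<in> ?V" "bracket G a b \<noteq> 0"
    using assms(3) by (auto simp: abelian_def)
  then have "bracket G a b \<in> ?C 1" by (auto intro!: span_base)
  then have "?C 1 \<noteq> {0}" using ab(3) by blast
  moreover have "?C 0 \<noteq> {0}" using ab by auto
  moreover define k where "k = (LEAST k. ?C k = {0})"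
  have k: "?C k = {0}" using assms(2) LeastI_ex unfolding nilpotent_def k_def by fast
  ultimately obtain m where m: "k = Suc (Suc m)" by (metis One_nat_def not0_implies_Suc)
  have "?C (Suc m) \<noteq> {0}" using not_less_Least[of "Suc m" "\<lambda>k. ?C k = {0}"] m k_def by auto
  moreover have "0 \<in> ?C (Suc m)" by (simp add: span_zero)
  ultimately obtain w where w: "w \<in> ?C (Suc m)" "w \<noteq> 0" by blast
  have wV: "w \<in> ?V" using w CV by blast
  have central: "bracket G x w = 0" if "x \<in> ?V" for x
  proof -
    have "bracket G x w \<in> ?C k"
      unfolding m lower_central.simps(2)[of G "Suc m"] using w that by (intro span_base) blast
    then show ?thesis using k by simp
  qed
  have "subspace {v\<in>?V. metric G v w = 0}" using wV by (auto simp: subspace_def)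
  moreover have "metric G (bracket G x y) w = 0" if "x \<in> ?V" "y \<in> ?V" for x y
    using invariant[of x y w] that wV central by simp
  ultimately have "?C 1 \<subseteq> {v\<in>?V. metric G v w = 0}"
    unfolding One_nat_def lower_central.simps by (intro span_minimal) auto
  then have "metric G w w = 0" using w C1 by blast
  then show ?thesis using wV w central by blast
qed

lemma lorentz_imp_orth_sum:
  fixes G :: "'a::real_vector ph_alg"
  assumes G: "pseudo_hermitian_quadratic G" "nilpotent G" "\<not> abelian G" "lorentz_hermitian G"
  shows "\<exists>A :: 'a ph_alg. hermitian A \<and> abelian A \<and> equivalent G (orth_sum A L_alg)"
proof -
  interpret nilpotent_quadratic "vspace G" "metric G" "cplx G" "bracket G"
    using nilpotent_quadratic_of G by blast
  obtain w where w: "w \<in> vspace G" "w \<noteq> 0" "metric G w w = 0" "\<forall>x\<in>vspace G. bracket G x w = 0"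
    using central_null_vector_exists G by blast
  obtain u where u: "u \<in> vspace G" "metric G u u = 0" "metric G u w = 1" "metric G u (cplx G w) = 0"
    using dual_null_vector w by blast
  interpret lorentz_null_center "vspace G" "metric G" "cplx G" "bracket G" w u
    using lorentz_positive_off_plane[OF G(4)] w u by unfold_locales auto
  obtain x y where "x \<in> vspace G" "y \<in> vspace G" "bracket G x y \<noteq> 0"
    using G(3) by (auto simp: abelian_def)
  then obtain x1 x2 x3 where "L_frame (vspace G) (metric G) (cplx G) (bracket G) x1 x2 x3"
    using L_frame_exists by blast
  then interpret L_frame "vspace G" "metric G" "cplx G" "bracket G" x1 x2 x3 .
  have "\<lparr>vspace = vspace G, bracket = bracket G, cplx = cplx G, metric = metric G\<rparr> = G"
    by (rule ph_alg.equality) simp_all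
  then have "equivalent G (orth_sum perp_alg L_alg)" using equivalent_orth_sum by (simp only:)
  then show ?thesis using perp_alg_hermitian_abelian by blast
qed

section \<open>The signature of the orthogonal sum\<close>

lemma orth_basis_Times:
  assumes "symmetric_form V \<phi>" "symmetric_form W \<psi>"
    and B: "orth_basis V \<phi> B" and C: "orth_basis W \<psi> C"
    and pos: "\<And>x. x \<in> V \<Longrightarrow> x \<noteq> 0 \<Longrightarrow> \<phi> x x > 0"
  defines "F \<equiv> (\<lambda>b. (b, 0)) ` B \<union> (\<lambda>c. (0, c)) ` C"
    and "\<theta> \<equiv> \<lambda>u v. \<phi> (fst u) (fst v) + \<psi> (snd u) (snd v)"
  shows "orth_basis (V \<times> W) \<theta> F" "card F = card B + card C"
    "card {e\<in>F. \<theta> e e < 0} = card {c\<in>C. \<psi> c c < 0}"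
proof -
  interpret V: symmetric_form V \<phi> by fact
  interpret W: symmetric_form W \<psi> by fact
  have BV: "b \<in> V" if "b \<in> B" for b using that B by (auto simp: orth_basis_def)
  have CW: "c \<in> W" if "c \<in> C" for c using that C by (auto simp: orth_basis_def)
  have nz: "0 \<notin> B" "0 \<notin> C"
    using B C by (auto simp: orth_basis_def)
  have fin: "finite B" "finite C" using B C by (auto simp: orth_basis_def)
  show "orth_basis (V \<times> W) \<theta> F"
    unfolding orth_basis_def
  proof (intro conjI)
    show "finite F" using fin by (simp add: F_def)
    show "F \<subseteq> V \<times> W" using BV CW by (auto simp: F_def)
    show "\<forall>b\<in>F. \<forall>c\<in>F. b \<noteq> c \<longrightarrow> \<theta> b c = 0"
      using B C BV CW by (simp add: F_def \<theta>_def orth_basis_def ball_Un)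
    show "\<forall>b\<in>F. \<theta> b b \<noteq> 0" using B C by (auto simp: F_def \<theta>_def orth_basis_def)
    show "\<forall>y\<in>V \<times> W. (\<forall>b\<in>F. \<theta> y b = 0) \<longrightarrow> y = 0"
    proof safe
      fix a l assume al: "a \<in> V" "l \<in> W" and o: "\<forall>b\<in>F. \<theta> (a, l) b = 0"
      have "\<forall>b\<in>B. \<phi> a b = 0" "\<forall>c\<in>C. \<psi> l c = 0" using o al BV CW by (simp_all add: F_def \<theta>_def ball_Un)
      then show "(a, l) = 0" using B C al by (simp add: orth_basis_def zero_prod_def)
    qed
  qed
  have "(\<lambda>b. (b, 0)) ` B \<inter> (\<lambda>c. (0, c)) ` C = {}" using nz by auto
  then show "card F = card B + card C"
    unfolding F_def using fin by (simp add: card_Un_disjoint card_image inj_on_def)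
  have "{e\<in>F. \<theta> e e < 0} = (\<lambda>c. (0, c)) ` {c\<in>C. \<psi> c c < 0}"
  proof -
    have "\<phi> b b > 0" if "b \<in> B" for b using that pos BV nz by metis
    then show ?thesis using BV CW by (force simp: F_def \<theta>_def)
  qed
  then show "card {e\<in>F. \<theta> e e < 0} = card {c\<in>C. \<psi> c c < 0}"
    by (simp add: card_image inj_on_def)
qed

text \<open>
  Pairings with the members of \<open>E\<close> are pairings with the members of \<open>F\<close>. The one delicate point is that
  \<open>f y = 0\<close> implies \<open>y = 0\<close>: all pairings \<open>\<phi> y x = \<theta> (f y) (f x)\<close> vanish, and \<open>\<phi>\<close> is nondegenerate.
\<close>

lemma (in hermitian_form) orth_basis_pullback:
  assumes f: "bij_betw f V W" and iso: "\<And>x y. x \<in> V \<Longrightarrow> y \<in> V \<Longrightarrow> \<theta> (f x) (f y) = \<phi> x y"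
    and F: "orth_basis W \<theta> F" and z: "\<And>y. y \<in> W \<Longrightarrow> \<theta> 0 y = 0"
  defines "E \<equiv> {y\<in>V. f y \<in> F}"
  shows "orth_basis V \<phi> E" "card E = card F"
    "card {e\<in>E. \<phi> e e < 0} = card {c\<in>F. \<theta> c c < 0}"
proof -
  have FW: "F \<subseteq> W" using F by (simp add: orth_basis_def)
  have inj: "inj_on f V" and fV: "f ` V = W" using f by (auto simp: bij_betw_def)
  have fE: "f ` E = F" using FW fV by (auto simp: E_def)
  have injE: "inj_on f E" by (rule inj_on_subset[OF inj]) (auto simp: E_def)
  show "card E = card F" using card_image[OF injE] fE by simp
  have "f ` {e\<in>E. \<phi> e e < 0} = {c\<in>F. \<theta> c c < 0}"
  proof -
    have "\<theta> (f e) (f e) = \<phi> e e" if "e \<in> E" for e using that iso by (simp add: E_def)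
    then show ?thesis unfolding fE[symmetric] by auto
  qed
  moreover have "card (f ` {e\<in>E. \<phi> e e < 0}) = card {e\<in>E. \<phi> e e < 0}"
    by (rule card_image, rule inj_on_subset[OF injE]) auto
  ultimately show "card {e\<in>E. \<phi> e e < 0} = card {c\<in>F. \<theta> c c < 0}" by simp
  show "orth_basis V \<phi> E"
    unfolding orth_basis_def
  proof (intro conjI ballI impI)
    show "finite E" using F finite_imageD[OF _ injE] by (simp add: fE orth_basis_def)
    show "E \<subseteq> V" by (auto simp: E_def)
  next
    fix b c assume bc: "b \<in> E" "c \<in> E" "b \<noteq> c"
    then have "f b \<noteq> f c" using injE by (meson inj_onD)
    then have "\<theta> (f b) (f c) = 0" using F bc by (simp add: orth_basis_def E_def)
    then show "\<phi> b c = 0" using iso bc by (simp add: E_def)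
  next
    fix b assume b: "b \<in> E"
    then have "\<theta> (f b) (f b) \<noteq> 0" using F by (simp add: orth_basis_def E_def)
    then show "\<phi> b b \<noteq> 0" using iso b by (simp add: E_def)
  next
    fix y assume y: "y \<in> V" "\<forall>b\<in>E. \<phi> y b = 0"
    have "\<theta> (f y) c = 0" if c: "c \<in> F" for c
    proof -
      obtain e where "e \<in> E" "c = f e" using c fE by blast
      then show ?thesis using y iso by (simp add: E_def)
    qed
    then have "f y = 0" using F y fV unfolding orth_basis_def by blast
    show "y = 0"
    proof (rule nondegenerate[OF y(1)])
      fix x assume x: "x \<in> V"
      have "\<phi> y x = \<theta> (f y) (f x)" using iso y x by simp
      then show "\<phi> y x = 0" using \<open>f y = 0\<close> z fV x by auto
    qed
  qed
qed

text \<open>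
  The null pairs \<open>x\<^sub>1\<close>, \<open>x\<^sub>3\<close> and \<open>J x\<^sub>1\<close>, \<open>J x\<^sub>3\<close> are hyperbolic planes; the difference of the two
  vectors is the negative direction of each.
\<close>

lemma L_alg_orth_basis:
  defines "C \<equiv> {L_vec X1 + L_vec X3, L_vec JX1 + L_vec JX3, L_vec X2, L_vec JX2,
    L_vec X1 - L_vec X3, L_vec JX1 - L_vec JX3}"
  shows "symmetric_form UNIV (metric L_alg)" "orth_basis UNIV (metric L_alg) C" "card C = 6"
    "card {c\<in>C. metric L_alg c c < 0} = 2"
proof -
  have eval: "metric L_alg c d = c $ X1 * d $ X3 + c $ X3 * d $ X1 + c $ JX1 * d $ JX3 + c $ JX3 * d $ JX1
    + c $ X2 * d $ X2 + c $ JX2 * d $ JX2" for c d by (simp add: L_alg_def sprod_def)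
  show "symmetric_form UNIV (metric L_alg)"
    by unfold_locales (auto simp: eval bilinear_map_on_def linear_map_on_def algebra_simps)
  have ne: "c \<noteq> d" if "c $ i \<noteq> d $ i" for c d :: "real ^ L_index" and i using that by auto
  have "distinct [L_vec X1 + L_vec X3, L_vec JX1 + L_vec JX3, L_vec X2, L_vec JX2,
    L_vec X1 - L_vec X3, L_vec JX1 - L_vec JX3]"
    using ne[where i = X1] ne[where i = X2] ne[where i = X3] ne[where i = JX1] ne[where i = JX2]
      ne[where i = JX3] by (auto simp: vec_eq_iff axis_def)
  from distinct_card[OF this] show "card C = 6" by (simp add: C_def)
  show "orth_basis UNIV (metric L_alg) C"
    unfolding orth_basis_def
  proof (intro conjI)
    show "\<forall>y\<in>UNIV. (\<forall>b\<in>C. metric L_alg y b = 0) \<longrightarrow> y = 0"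
    proof (intro ballI impI)
      fix y :: "real ^ L_index"
      assume "\<forall>b\<in>C. metric L_alg y b = 0"
      then show "y = 0" by (intro L_vec_eqI) (simp_all add: C_def eval axis_def)
    qed
  qed (auto simp: C_def eval axis_def)
  have "{c\<in>C. metric L_alg c c < 0} = {L_vec X1 - L_vec X3, L_vec JX1 - L_vec JX3}"
    by (auto simp: C_def eval axis_def)
  moreover have "L_vec X1 - L_vec X3 \<noteq> L_vec JX1 - L_vec JX3" by (rule ne[of _ X1]) (simp add: axis_def)
  ultimately show "card {c\<in>C. metric L_alg c c < 0} = 2" by simp
qed

lemma hermitian_form_of:
  assumes "pseudo_hermitian G" shows "hermitian_form (vspace G) (metric G) (cplx G)"
  using assms unfolding pseudo_hermitian_def lie_algebra_def complex_structure_def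
  by unfold_locales auto

lemma orth_sum_imp_lorentz:
  fixes G :: "'a::real_vector ph_alg" and A :: "'b::real_vector ph_alg"
  assumes G: "pseudo_hermitian G" and A: "hermitian A" and eq: "equivalent G (orth_sum A L_alg)"
  shows "lorentz_hermitian G"
proof -
  interpret G: hermitian_form "vspace G" "metric G" "cplx G" using G by (rule hermitian_form_of)
  interpret A: hermitian_form "vspace A" "metric A" "cplx A"
    using A by (intro hermitian_form_of) (simp add: hermitian_def)
  let ?H = "orth_sum A L_alg"
  have H: "vspace ?H = vspace A \<times> UNIV"
    "metric ?H = (\<lambda>u v. metric A (fst u) (fst v) + metric L_alg (snd u) (snd v))"
    by (simp_all add: orth_sum_def L_alg_def)
  have posA: "\<And>x. x \<in> vspace A \<Longrightarrow> x \<noteq> 0 \<Longrightarrow> metric A x x > 0" using A by (simp add: hermitian_def)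
  then obtain B where B: "orth_basis (vspace A) (metric A) B" "even (card B)"
    using A.unitary_basis_exists by blast
  obtain f where f: "bij_betw f (vspace G) (vspace A \<times> UNIV)"
    and iso: "\<And>x y. x \<in> vspace G \<Longrightarrow> y \<in> vspace G \<Longrightarrow> metric ?H (f x) (f y) = metric G x y"
    using eq unfolding equivalent_def H(1) by blast
  obtain C where C: "orth_basis UNIV (metric L_alg) C" "card C = 6"
      "card {c\<in>C. metric L_alg c c < 0} = 2"
    using L_alg_orth_basis(2-4) by blast
  define F where "F = (\<lambda>b. (b, 0)) ` B \<union> (\<lambda>c. (0, c)) ` C"
  note T = orth_basis_Times[OF A.symmetric_form_axioms L_alg_orth_basis(1) B(1) C(1) posA, folded F_def]
  have F: "orth_basis (vspace A \<times> UNIV) (metric ?H) F" "card F = card B + 6"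
      "card {e\<in>F. metric ?H e e < 0} = 2"
    unfolding H(2) using T C(2,3) by simp_all
  have z: "metric ?H 0 y = 0" if "y \<in> vspace A \<times> UNIV" for y
    unfolding H(2) using that symmetric_form.form_minus_zero(3)[OF L_alg_orth_basis(1)] by auto
  define E where "E = {y\<in>vspace G. f y \<in> F}"
  note P = G.orth_basis_pullback[OF f iso F(1) z, folded E_def]
  have E: "orth_basis (vspace G) (metric G) E" "card E = card B + 6"
      "card {e\<in>E. metric G e e < 0} = 2"
    using P F(2,3) by simp_all
  obtain n where n: "card B = 2 * n" using B(2) by blast
  show ?thesis
    unfolding lorentz_hermitian_def
    \<comment> \<open>\<open>dim G = card B + 6 = 2 (n + 3)\<close>\<close>
    using G G.orth_basis_signature[OF E(1,3)] E(2) n by (intro conjI exI[of _ "n + 3"]) auto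
qed

theorem corollary2p5:
  fixes G :: "'a::real_vector ph_alg"
  assumes "pseudo_hermitian_quadratic G" and "nilpotent G" and "\<not> abelian G"
  shows "lorentz_hermitian G \<longleftrightarrow>
    (\<exists>A :: 'a ph_alg. hermitian A \<and> abelian A \<and> equivalent G (orth_sum A L_alg))"
  using lorentz_imp_orth_sum[OF assms] orth_sum_imp_lorentz assms(1)
  unfolding pseudo_hermitian_quadratic_def by blast

end
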